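(* Let $G$ be a Hausdorff topological group and let $X$ be a distributive binary $G$-space (with $X$ Hausdorff). Then any two orbits in $X$ either are disjoint or coincide; that is, for all $x,x'\in X$, either $[x]\cap[x']=\emptyset$ or $[x]=[x']$.
   Context: A binary action of a topological group $G$ on a topological space $X$ is a continuous map $\alpha : G\times X^2\to X$, written $g(x,x')=\alpha(g,x,x')$, such that $gh(x,x')=g(x,h(x,x'))$ and $e(x,x')=x'$ for all $g,h\in G$, $x,x'\in X$, where $e$ is the identity of $G$ and $gh(x,x')$ means $(gh)(x,x')$. A space $X$ with a fixed binary action of $G$ is called a binary $G$-space. A binary $G$-space is distributive if $g(h(x,x'),h(x,x''))=h(x,g(x',x''))$ for all $x,x',x''\in X$ and $g,h\in G$. A subset $A\subset X$ is bi-invariant if $\{g(a,b) : g\in G,\ a,b\in A\}=A$. The orbit $[x]$ of a point $x\in X$ is the minimal bi-invariant subset of $X$ containing $x$. *)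

theory Defs
  imports "HOL-Algebra.Group" "HOL-Analysis.T1_Spaces"
begin

locale topological_group = group G for G (structure) +
  fixes T :: "'g topology"
  assumes topspace_eq_carrier: "topspace T = carrier G"
    and continuous_mult: "continuous_map (prod_topology T T) T (\<lambda>(g, h). g \<otimes> h)"
    and continuous_inv: "continuous_map T T (\<lambda>g. inv g)"

text \<open>The value \<open>\<alpha> g x x'\<close> of a curried action is \<open>g(x, x')\<close>.\<close>

locale binary_G_space = topological_group G T
  for G :: "('g, 'm) monoid_scheme" (structure) and T :: "'g topology" +
  fixes X :: "'x topology" and \<alpha> :: "'g \<Rightarrow> 'x \<Rightarrow> 'x \<Rightarrow> 'x"
  assumes continuous_action:
      "continuous_map (prod_topology T (prod_topology X X)) X (\<lambda>(g, x, x'). \<alpha> g x x')"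
    and action_mult:
      "\<lbrakk>g \<in> carrier G; h \<in> carrier G; x \<in> topspace X; x' \<in> topspace X\<rbrakk>
        \<Longrightarrow> \<alpha> (g \<otimes> h) x x' = \<alpha> g x (\<alpha> h x x')"
    and action_one:
      "\<lbrakk>x \<in> topspace X; x' \<in> topspace X\<rbrakk> \<Longrightarrow> \<alpha> \<one> x x' = x'"

locale distributive_binary_G_space = binary_G_space +
  assumes distributive:
      "\<lbrakk>g \<in> carrier G; h \<in> carrier G; x \<in> topspace X; x' \<in> topspace X; x'' \<in> topspace X\<rbrakk>
        \<Longrightarrow> \<alpha> g (\<alpha> h x x') (\<alpha> h x x'') = \<alpha> h x (\<alpha> g x' x'')"

definition bi_invariant ::
    "('g, 'm) monoid_scheme \<Rightarrow> 'x topology \<Rightarrow> ('g \<Rightarrow> 'x \<Rightarrow> 'x \<Rightarrow> 'x) \<Rightarrow> 'x set \<Rightarrow> bool" where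
  "bi_invariant G X \<alpha> A \<longleftrightarrow>
    A \<subseteq> topspace X \<and> {\<alpha> g a b | g a b. g \<in> carrier G \<and> a \<in> A \<and> b \<in> A} = A"

text \<open>The minimum is taken with respect to inclusion. It exists for every point of a binary
  \<open>G\<close>-space, see \<open>orbit_eq_Inter\<close> and the lemmas following it.\<close>

definition orbit ::
    "('g, 'm) monoid_scheme \<Rightarrow> 'x topology \<Rightarrow> ('g \<Rightarrow> 'x \<Rightarrow> 'x \<Rightarrow> 'x) \<Rightarrow> 'x \<Rightarrow> 'x set" where
  "orbit G X \<alpha> x = (LEAST A. bi_invariant G X \<alpha> A \<and> x \<in> A)"

context binary_G_space
begin

lemma action_closed:
  assumes "g \<in> carrier G" "x \<in> topspace X" "x' \<in> topspace X"
  shows "\<alpha> g x x' \<in> topspace X"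
proof -
  have "(\<lambda>(g, x, x'). \<alpha> g x x') \<in> topspace (prod_topology T (prod_topology X X)) \<rightarrow> topspace X"
    using continuous_action by (rule continuous_map_funspace)
  moreover have "(g, x, x') \<in> topspace (prod_topology T (prod_topology X X))"
    using assms by (simp add: topspace_eq_carrier)
  ultimately have "(\<lambda>(g, x, x'). \<alpha> g x x') (g, x, x') \<in> topspace X"
    by (rule Pi_mem)
  then show ?thesis by simp
qed

lemma bi_invariant_iff:
  "bi_invariant G X \<alpha> A \<longleftrightarrow>
    A \<subseteq> topspace X \<and> (\<forall>g\<in>carrier G. \<forall>a\<in>A. \<forall>b\<in>A. \<alpha> g a b \<in> A)"
proof
  assume "A \<subseteq> topspace X \<and> (\<forall>g\<in>carrier G. \<forall>a\<in>A. \<forall>b\<in>A. \<alpha> g a b \<in> A)"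
  moreover from this have "a = \<alpha> \<one> a a" if "a \<in> A" for a
    using that action_one by (metis subsetD)
  ultimately show "bi_invariant G X \<alpha> A"
    unfolding bi_invariant_def using one_closed by blast
qed (unfold bi_invariant_def, blast)

lemma bi_invariant_topspace: "bi_invariant G X \<alpha> (topspace X)"
  by (simp add: bi_invariant_iff action_closed)

lemma orbit_eq_Inter:
  assumes "x \<in> topspace X"
  shows "orbit G X \<alpha> x = \<Inter>{A. bi_invariant G X \<alpha> A \<and> x \<in> A}"
  unfolding orbit_def
proof (rule Least_equality)
  have "\<Inter>{A. bi_invariant G X \<alpha> A \<and> x \<in> A} \<subseteq> topspace X"
    using assms bi_invariant_topspace by blast
  then show "bi_invariant G X \<alpha> (\<Inter>{A. bi_invariant G X \<alpha> A \<and> x \<in> A}) \<and>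
      x \<in> \<Inter>{A. bi_invariant G X \<alpha> A \<and> x \<in> A}"
    by (auto simp: bi_invariant_iff)
qed blast

lemma bi_invariant_orbit: "x \<in> topspace X \<Longrightarrow> bi_invariant G X \<alpha> (orbit G X \<alpha> x)"
  using bi_invariant_topspace by (auto simp: orbit_eq_Inter bi_invariant_iff)

lemma mem_orbit: "x \<in> topspace X \<Longrightarrow> x \<in> orbit G X \<alpha> x"
  by (auto simp: orbit_eq_Inter)

lemma orbit_subset:
  "\<lbrakk>x \<in> topspace X; bi_invariant G X \<alpha> A; x \<in> A\<rbrakk> \<Longrightarrow> orbit G X \<alpha> x \<subseteq> A"
  by (auto simp: orbit_eq_Inter)

end

end

(* By distributivity every translation y \<mapsto> g(a, y) is an automorphism of the action. If
   a and b belong to the orbit [x] and [b] = [x], then the translation by (g, a) maps [b] into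
   [g(a, b)] and permutes [x], whence [g(a, b)] = [x]. Hence the points of [x] whose orbit is
   [x] form a bi-invariant set containing x, which must be all of [x]. *)

theory Submission
  imports Defs
begin

context binary_G_space
begin

lemma action_inv_cancel:
  assumes "g \<in> carrier G" "x \<in> topspace X" "x' \<in> topspace X"
  shows "\<alpha> g x (\<alpha> (inv g) x x') = x'"
  using assms action_mult[of g "inv g" x x'] by (simp add: action_one)

end

context distributive_binary_G_space
begin

text \<open>Distributivity, read as \<open>\<alpha> h (\<alpha> g a y) (\<alpha> g a z) = \<alpha> g
  a (\<alpha> h y z)\<close>, makes the translation \<open>\<alpha> g a\<close> a homomorphism of
  the action, and preimages of closed sets under homomorphisms are closed.\<close>

lemma bi_invariant_vimage_translation:
  assumes "g \<in> carrier G" "a \<in> topspace X" "bi_invariant G X \<alpha> S"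
  shows "bi_invariant G X \<alpha> {y \<in> topspace X. \<alpha> g a y \<in> S}"
proof -
  have "\<alpha> g a (\<alpha> h y z) \<in> S"
    if "h \<in> carrier G" "y \<in> topspace X" "z \<in> topspace X" "\<alpha> g a y \<in> S" "\<alpha> g a z \<in> S" for h y z
    using assms that distributive[of h g a y z] by (metis bi_invariant_iff)
  then show ?thesis
    by (auto simp: bi_invariant_iff action_closed)
qed

text \<open>The preimage of the orbit of \<open>\<alpha> g a b\<close> under the translation is
  bi-invariant and contains \<open>b\<close>, so by minimality it contains the whole orbit of
  \<open>b\<close>.\<close>

lemma translation_mem_orbit:
  assumes "g \<in> carrier G" "a \<in> topspace X" "b \<in> topspace X" "c \<in> orbit G X \<alpha> b"
  shows "\<alpha> g a c \<in> orbit G X \<alpha> (\<alpha> g a b)"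
proof -
  let ?S = "orbit G X \<alpha> (\<alpha> g a b)"
  have "\<alpha> g a b \<in> topspace X"
    using assms by (simp add: action_closed)
  then have "bi_invariant G X \<alpha> {y \<in> topspace X. \<alpha> g a y \<in> ?S}" "\<alpha> g a b \<in> ?S"
    using assms by (simp_all add: bi_invariant_vimage_translation bi_invariant_orbit mem_orbit)
  then show ?thesis
    using orbit_subset[OF assms(3)] assms(3,4) by blast
qed

lemma orbit_translation:
  assumes "g \<in> carrier G" "b \<in> topspace X" "a \<in> orbit G X \<alpha> b"
  shows "orbit G X \<alpha> (\<alpha> g a b) = orbit G X \<alpha> b"
proof
  have bi: "bi_invariant G X \<alpha> (orbit G X \<alpha> b)" and b: "b \<in> orbit G X \<alpha> b"
    using assms by (simp_all add: bi_invariant_orbit mem_orbit)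
  have sub: "orbit G X \<alpha> b \<subseteq> topspace X"
    and closed: "\<And>h c. \<lbrakk>h \<in> carrier G; c \<in> orbit G X \<alpha> b\<rbrakk> \<Longrightarrow> \<alpha> h a c \<in> orbit G X \<alpha> b"
    using bi assms(3) by (auto simp: bi_invariant_iff)
  show "orbit G X \<alpha> (\<alpha> g a b) \<subseteq> orbit G X \<alpha> b"
    using closed[OF assms(1) b] sub by (intro orbit_subset bi) auto
  show "orbit G X \<alpha> b \<subseteq> orbit G X \<alpha> (\<alpha> g a b)"
  proof
    fix c assume c: "c \<in> orbit G X \<alpha> b"
    \<comment> \<open>The inverse translation keeps \<open>c\<close> inside the orbit of
      \<open>b\<close>, because \<open>a\<close> lies there too; translating back by
      \<open>g\<close> then lands in the orbit of \<open>\<alpha> g a b\<close>.\<close>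
    then have "\<alpha> g a (\<alpha> (inv g) a c) \<in> orbit G X \<alpha> (\<alpha> g a b)"
      using assms sub closed by (intro translation_mem_orbit) auto
    moreover have "\<alpha> g a (\<alpha> (inv g) a c) = c"
      using assms c sub by (intro action_inv_cancel) auto
    ultimately show "c \<in> orbit G X \<alpha> (\<alpha> g a b)" by simp
  qed
qed

lemma orbit_eq_if_mem:
  assumes "x \<in> topspace X" "z \<in> orbit G X \<alpha> x"
  shows "orbit G X \<alpha> z = orbit G X \<alpha> x"
proof -
  let ?B = "{z \<in> orbit G X \<alpha> x. orbit G X \<alpha> z = orbit G X \<alpha> x}"
  have bi: "bi_invariant G X \<alpha> (orbit G X \<alpha> x)"
    using assms(1) by (rule bi_invariant_orbit)
  \<comment> \<open>Since \<open>b\<close> has the same orbit as \<open>x\<close>, the point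
    \<open>a\<close> lies in the orbit of \<open>b\<close>, as \<open>orbit_translation\<close>
    requires.\<close>
  have "\<alpha> g a b \<in> ?B" if "g \<in> carrier G" "a \<in> ?B" "b \<in> ?B" for g a b
    using that bi orbit_translation[of g b a] by (auto simp: bi_invariant_iff)
  then have "bi_invariant G X \<alpha> ?B"
    using bi by (auto simp: bi_invariant_iff)
  then show ?thesis
    using orbit_subset[OF assms(1)] mem_orbit[OF assms(1)] assms(2) by blast
qed

end

theorem proposition2:
  fixes G :: "('g, 'm) monoid_scheme" and T :: "'g topology"
    and X :: "'x topology" and \<alpha> :: "'g \<Rightarrow> 'x \<Rightarrow> 'x \<Rightarrow> 'x"
  assumes "distributive_binary_G_space G T X \<alpha>"
    and "Hausdorff_space T"
    and "Hausdorff_space X"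
  shows "\<forall>x\<in>topspace X. \<forall>x'\<in>topspace X.
    orbit G X \<alpha> x \<inter> orbit G X \<alpha> x' = {} \<or> orbit G X \<alpha> x = orbit G X \<alpha> x'"
  \<comment> \<open>The orbit of a common point equals both orbits.\<close>
  using distributive_binary_G_space.orbit_eq_if_mem[OF assms(1)] by blast

end
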